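(* Let $(f,g)$ belong to one of the three families (F1), (F2), (F3) described in the context, and write $f=f_1+f_2+f_3$, $g=g_1+g_2+g_3$ for the decompositions into homogeneous components. If $f_1g_1=0$ and $(f_1,g_1)\neq(0,0)$, then $$2\leq I_0(f,g)\leq 7.$$ Moreover, the maximum value $7$ is attained in family (F2) (partition $\lambda(2)=(3,2,1^2)$ with $LT_{21}=\{y^3,-yz^2,y^2z\}$) when the coefficients satisfy $C_{10}^{12}=0$, $C_{01}^{12}=0$, $C_{01}^{21}=0$, $C_{20}^{21}=0$, $C_{11}^{21}=0$ and $C_{10}^{21}=C_{02}^{21}\neq 0$.
   Context: All coefficients $C_{hk}^{rs}$ below are complex numbers. The families are local representations $f\,dy+g\,dz$ (in the chart $x=1$) at the singular point $[1:0:0]$ of degree-2 foliation $1$-forms $\omega_\lambda=A\,dx+B\,dy+C\,dz$ on $\mathbb{CP}^2$ (with $xA+yB+zC=0$, $f=B(1,y,z)$, $g=C(1,y,z)$): (F1) partition $\lambda(1)=(3^2,1)$ of $7$, leading terms $LT=\{y^3,-z^3,yz^2\}$: $f=-C_{10}^{03}y-y^{2}-C_{01}^{03}z-C_{11}^{03}yz+C_{11}^{12}z^{2}-z^{3}$, $g=-C_{10}^{12}y-C_{20}^{12}y^{2}-C_{01}^{12}z-C_{11}^{12}yz+yz^{2}$. (F2) partition $\lambda(2)=(3,2,1^2)$ of $7$, leading terms $LT_{21}=\{y^3,-yz^2,y^2z\}$, with $C_{02}^{21}\neq0$: $f=-C_{10}^{12}y-y^{2}-C_{01}^{12}z+C_{20}^{21}yz+C_{11}^{21}z^{2}-yz^{2}$,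 $g=-C_{10}^{21}y-C_{20}^{21}y^{2}-C_{01}^{21}z-C_{11}^{21}yz+y^{2}z-C_{02}^{21}z^{2}$. (F3) partition $\lambda(2)=(3,2,1^2)$ of $7$, leading terms $LT_{22}=\{yz^2,-y^2z,y^3\}$, with $C_{02}^{30}\neq0$: $f=-C_{10}^{21}y-C_{01}^{21}z+C_{20}^{30}yz-y^{2}z+(C_{11}^{30}-1)z^{2}$, $g=-C_{10}^{30}y-C_{20}^{30}y^{2}+y^{3}-C_{01}^{30}z-C_{11}^{30}yz-C_{02}^{30}z^{2}$. $f_i,g_i\in\mathbb{C}[y,z]$ denote the homogeneous components of degree $i$. $I_0(f,g)=\dim_{\mathbb{C}}\mathcal{O}_{\mathbb{C}^2,(0,0)}/\langle f,g\rangle$ is the intersection index of $f$ and $g$ at the origin ($\infty$ if the dimension is infinite). *)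

theory Defs
  imports
    "HOL-Analysis.Infinite_Sum"
    "HOL-Computational_Algebra.Polynomial_FPS"
    "HOL-Algebra.Embedded_Algebras"
    "HOL-Algebra.QuotRing"
    "HOL-Library.Extended_Nat"
begin

section \<open>Polynomials in two variables\<close>

text \<open>
  The ring \<open>\<complex>[y,z]\<close> is the type \<^typ>\<open>complex poly poly\<close>; the outer variable is \<open>y\<close> and the
  inner one is \<open>z\<close>, so the coefficient of \<open>y\<^sup>i z\<^sup>j\<close> in \<open>p\<close> is \<open>poly.coeff (poly.coeff p i) j\<close>.
\<close>

definition Y :: "complex poly poly" where "Y = [:0, 1:]"

definition Z :: "complex poly poly" where "Z = [:[:0, 1:]:]"

definition K :: "complex \<Rightarrow> complex poly poly" where "K c = [:[:c:]:]"

definition hom_component :: "nat \<Rightarrow> complex poly poly \<Rightarrow> complex poly poly" where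
  "hom_component d p = (\<Sum>i\<le>d. K (poly.coeff (poly.coeff p i) (d - i)) * Y ^ i * Z ^ (d - i))"


section \<open>The local ring at the origin and the intersection index\<close>

text \<open>
  A germ at the origin of a holomorphic function of \<open>(y,z)\<close> is identified with its Taylor series
  \<open>\<Sum> a\<^sub>i\<^sub>j y\<^sup>i z\<^sup>j\<close>, so that the local ring is the ring of those power series that
  converge absolutely on some polydisc. As for polynomials, \<open>a\<^sub>i\<^sub>j\<close> is \<open>fps_nth (fps_nth F i) j\<close>.
\<close>

definition convergent_series :: "complex fps fps \<Rightarrow> bool" where
  "convergent_series F \<longleftrightarrow>
     (\<exists>r>0. (\<lambda>(i, j). fps_nth (fps_nth F i) j * complex_of_real r ^ (i + j)) abs_summable_on UNIV)"

definition local_ring :: "complex fps fps ring" where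
  "local_ring =
     \<lparr>carrier = {F. convergent_series F}, mult = (*), one = 1, zero = 0, add = (+)\<rparr>"

definition germ :: "complex poly poly \<Rightarrow> complex fps fps" where
  "germ p = fps_of_poly (map_poly fps_of_poly p)"

definition quotient_ring :: "complex poly poly \<Rightarrow> complex poly poly \<Rightarrow> complex fps fps set ring" where
  "quotient_ring f g = local_ring Quot (Idl\<^bsub>local_ring\<^esub> {germ f, germ g})"

text \<open>
  The library measures dimensions over a subset of the ring itself; here this is the image of
  \<open>\<complex>\<close> in the quotient.
\<close>

definition quotient_scalars :: "complex poly poly \<Rightarrow> complex poly poly \<Rightarrow> complex fps fps set set" where
  "quotient_scalars f g =
     range (\<lambda>c. Idl\<^bsub>local_ring\<^esub> {germ f, germ g} +>\<^bsub>local_ring\<^esub> germ (K c))"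

definition intersection_index :: "complex poly poly \<Rightarrow> complex poly poly \<Rightarrow> enat" where
  "intersection_index f g =
     (let Q = quotient_ring f g; S = quotient_scalars f g in
      if ring.finite_dimension Q S (carrier Q) then enat (ring.dim Q S (carrier Q)) else \<infinity>)"


section \<open>The three families\<close>

text \<open>
  The coefficient \<open>C\<^sub>h\<^sub>k\<close> with upper index \<open>rs\<close> is written \<open>C r s h k\<close>; of the function \<open>C\<close>
  only the values occurring in the respective formulas matter.
\<close>

type_synonym coefficients = "nat \<Rightarrow> nat \<Rightarrow> nat \<Rightarrow> nat \<Rightarrow> complex"

definition fam_f1 :: "coefficients \<Rightarrow> complex poly poly" where
  "fam_f1 C = - K (C 0 3 1 0) * Y - Y^2 - K (C 0 3 0 1) * Z - K (C 0 3 1 1) * Y * Z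
          + K (C 1 2 1 1) * Z^2 - Z^3"

definition fam_g1 :: "coefficients \<Rightarrow> complex poly poly" where
  "fam_g1 C = - K (C 1 2 1 0) * Y - K (C 1 2 2 0) * Y^2 - K (C 1 2 0 1) * Z
          - K (C 1 2 1 1) * Y * Z + Y * Z^2"

definition fam_f2 :: "coefficients \<Rightarrow> complex poly poly" where
  "fam_f2 C = - K (C 1 2 1 0) * Y - Y^2 - K (C 1 2 0 1) * Z + K (C 2 1 2 0) * Y * Z
          + K (C 2 1 1 1) * Z^2 - Y * Z^2"

definition fam_g2 :: "coefficients \<Rightarrow> complex poly poly" where
  "fam_g2 C = - K (C 2 1 1 0) * Y - K (C 2 1 2 0) * Y^2 - K (C 2 1 0 1) * Z
          - K (C 2 1 1 1) * Y * Z + Y^2 * Z - K (C 2 1 0 2) * Z^2"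

definition fam_f3 :: "coefficients \<Rightarrow> complex poly poly" where
  "fam_f3 C = - K (C 2 1 1 0) * Y - K (C 2 1 0 1) * Z + K (C 3 0 2 0) * Y * Z - Y^2 * Z
          + K (C 3 0 1 1 - 1) * Z^2"

definition fam_g3 :: "coefficients \<Rightarrow> complex poly poly" where
  "fam_g3 C = - K (C 3 0 1 0) * Y - K (C 3 0 2 0) * Y^2 + Y^3 - K (C 3 0 0 1) * Z
          - K (C 3 0 1 1) * Y * Z - K (C 3 0 0 2) * Z^2"

definition F1 :: "(complex poly poly \<times> complex poly poly) set" where
  "F1 = {(fam_f1 C, fam_g1 C) | C. True}"

definition F2 :: "(complex poly poly \<times> complex poly poly) set" where
  "F2 = {(fam_f2 C, fam_g2 C) | C. C 2 1 0 2 \<noteq> 0}"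

definition F3 :: "(complex poly poly \<times> complex poly poly) set" where
  "F3 = {(fam_f3 C, fam_g3 C) | C. C 3 0 0 2 \<noteq> 0}"

end

theory Submission
  imports Defs "HOL-Computational_Algebra.Fundamental_Theorem_Algebra"
begin

text \<open>
  In each family seven monomials span \<open>\<complex>[y,z]/(f,g)\<close>. Hence \<open>y\<close> and \<open>z\<close> are algebraic over
  \<open>\<complex>\<close> modulo \<open>(f,g)\<close>; in the local ring the nonzero roots of their equations only contribute
  units, so powers of \<open>y\<close> and \<open>z\<close> lie in the ideal, every germ is congruent to a polynomial, and
  the seven monomials span the local quotient as well. If one of the linear parts vanishes, the value at
  the origin and the derivative along the kernel of the other linear part are two functionals vanishing on
  the ideal, which gives the lower bound. In the extremal case the coefficients of the restriction
  to the smooth branch of \<open>g = 0\<close>, truncated at order seven, are seven such functionals.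
\<close>

section \<open>Convergent power series\<close>

text \<open>The number seven goes back to the projective relation \<open>xA + yB + zC = 0\<close>.
  In the chart it says that \<open>y f + z g\<close> equals \<open>-A(1,y,z)\<close>, so the terms
  of degree four cancel and a third cubic relation appears beside \<open>f\<close> and
  \<open>g\<close>. Reduction by these three leaves seven monomials. In (F1) the third relation
  rewrites \<open>y^3\<close>; in (F2) and (F3) it contains \<open>z^3\<close> with coefficient
  \<open>-m\<close>, where \<open>m\<close> is the coefficient assumed nonzero, and division by
  \<open>m\<close> makes \<open>z^3\<close> reducible. This reduction is finite and reaches
  polynomials only, whereas a germ is an infinite series and a linear span is not closed under
  limits. In the extremal case \<open>f = -y (y + z^2)\<close>, and along the branch
  \<open>y = -z^2 + z^5/m + ...\<close> the factors have orders 2 and 5, which add up to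
  seven.\<close>

definition cst :: "complex \<Rightarrow> complex fps fps" where "cst c = fps_const (fps_const c)"

definition y :: "complex fps fps" where "y = fps_X"

definition z :: "complex fps fps" where "z = fps_const fps_X"

lemma cst_simps:
  "cst 0 = 0" "cst 1 = 1" "cst (a + b) = cst a + cst b" "cst (a * b) = cst a * cst b"
  "cst (- a) = - cst a" "cst (a - b) = cst a - cst b"
  by (simp_all add: cst_def flip: fps_const_neg)

lemma cst_nth: "fps_nth (fps_nth (cst c * F) i) j = c * fps_nth (fps_nth F i) j"
  by (simp add: cst_def)

lemma cst_inverse: "c \<noteq> 0 \<Longrightarrow> cst (inverse c) * cst c = 1"
  by (simp flip: cst_simps)

lemma y_power_nth: "fps_nth (y ^ k * F) i = (if i < k then 0 else fps_nth F (i - k))"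
  by (simp add: y_def fps_X_power_mult_nth)

lemma z_power_nth: "fps_nth (fps_nth (z ^ k * F) i) j = (if j < k then 0 else fps_nth (fps_nth F i) (j - k))"
  by (simp add: z_def fps_const_power fps_X_power_mult_nth)

section \<open>Coefficient growth and closure properties of convergent series\<close>

text \<open>Cauchy estimates: each summand is at most the whole absolute sum, which gives geometric
  growth; conversely, geometric growth is summable on a smaller polydisc. The closure properties
  become plain inequalities in this form.\<close>

lemma convergent_series_iff:
  "convergent_series F \<longleftrightarrow> (\<exists>M. \<exists>R>0. \<forall>i j. norm (fps_nth (fps_nth F i) j) \<le> M * R ^ (i + j))"
proof
  assume "convergent_series F"
  then obtain r where r: "r > 0"
    and sum: "(\<lambda>(i, j). fps_nth (fps_nth F i) j * complex_of_real r ^ (i + j)) abs_summable_on UNIV"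
    unfolding convergent_series_def by blast
  define M where
    "M = (\<Sum>\<^sub>\<infinity>p. norm (case p of (i, j) \<Rightarrow> fps_nth (fps_nth F i) j * complex_of_real r ^ (i + j)))"
  have "norm (fps_nth (fps_nth F i) j) \<le> M * (1 / r) ^ (i + j)" for i j
  proof -
    have "(\<Sum>p\<in>{(i, j)}. norm (case p of (i, j) \<Rightarrow> fps_nth (fps_nth F i) j * complex_of_real r ^ (i + j))) \<le> M"
      unfolding M_def by (rule finite_sum_le_infsum[OF sum]) auto
    hence "norm (fps_nth (fps_nth F i) j) * r ^ (i + j) \<le> M"
      using r by (simp add: norm_mult norm_power)
    thus ?thesis
      using r by (simp add: field_simps power_divide)
  qed
  thus "\<exists>M. \<exists>R>0. \<forall>i j. norm (fps_nth (fps_nth F i) j) \<le> M * R ^ (i + j)"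
    using r by (intro exI[of _ M] exI[of _ "1 / r"]) auto
next
  assume "\<exists>M. \<exists>R>0. \<forall>i j. norm (fps_nth (fps_nth F i) j) \<le> M * R ^ (i + j)"
  then obtain M R where R: "R > 0" and bound: "\<And>i j. norm (fps_nth (fps_nth F i) j) \<le> M * R ^ (i + j)"
    by blast
  \<comment> \<open>Half the critical radius, so that the terms are dominated by a product of two
    geometric series of ratio 1/2.\<close>
  define r where "r = 1 / (2 * R)"
  have r: "r > 0" using R by (simp add: r_def)
  have geo: "(\<lambda>i::nat. (1/2::real) ^ i) summable_on UNIV"
    by (rule summable_nonneg_imp_summable_on) (auto intro: summable_geometric)
  have "(\<lambda>(i::nat, j::nat). (1/2::real) ^ i * (1/2) ^ j) summable_on (UNIV \<times> UNIV)"
    by (rule summable_on_SigmaI[where g = "\<lambda>i. (1/2) ^ i * (\<Sum>\<^sub>\<infinity>j. (1/2::real) ^ j)"])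
       (auto intro!: has_sum_cmult_right has_sum_infsum summable_on_cmult_left geo)
  hence "(\<lambda>(i::nat, j::nat). M * ((1/2::real) ^ i * (1/2) ^ j)) summable_on UNIV"
    using summable_on_cmult_right[of "\<lambda>(i::nat, j::nat). (1/2::real) ^ i * (1/2) ^ j" UNIV M]
    by (simp add: case_prod_unfold)
  hence "(\<lambda>(i, j). fps_nth (fps_nth F i) j * complex_of_real r ^ (i + j)) abs_summable_on UNIV"
  proof (rule abs_summable_on_comparison_test')
    fix p :: "nat \<times> nat"
    obtain i j where p: "p = (i, j)" by (cases p)
    have "norm (fps_nth (fps_nth F i) j * complex_of_real r ^ (i + j)) \<le> M * R ^ (i + j) * r ^ (i + j)"
      using r bound by (simp add: norm_mult norm_power mult_right_mono)
    also have "\<dots> = M * ((1/2) ^ i * (1/2) ^ j)"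
      using R by (simp add: r_def power_divide power_mult_distrib power_add field_simps)
    finally show "norm (case p of (i, j) \<Rightarrow> fps_nth (fps_nth F i) j * complex_of_real r ^ (i + j))
        \<le> (case p of (i, j) \<Rightarrow> M * ((1/2) ^ i * (1/2) ^ j))"
      by (simp add: p)
  qed
  thus "convergent_series F"
    unfolding convergent_series_def using r by blast
qed

lemma convergent_seriesI:
  "R > 0 \<Longrightarrow> (\<And>i j. norm (fps_nth (fps_nth F i) j) \<le> M * R ^ (i + j)) \<Longrightarrow> convergent_series F"
  unfolding convergent_series_iff by blast

lemma convergent_seriesE:
  assumes "convergent_series F"
  obtains M R where "M \<ge> 0" "R > 0" "\<And>i j. norm (fps_nth (fps_nth F i) j) \<le> M * R ^ (i + j)"
proof -
  from assms obtain M R where R: "R > 0" and *: "\<And>i j. norm (fps_nth (fps_nth F i) j) \<le> M * R ^ (i + j)"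
    unfolding convergent_series_iff by blast
  have "M \<ge> 0"
    using order.trans[OF norm_ge_zero *[of 0 0]] by simp
  with R * show thesis by (intro that) auto
qed

lemma convergent_series_cst [simp]: "convergent_series (cst c)"
  by (rule convergent_seriesI[of 1 _ "norm c"]) (auto simp: cst_def)

lemma convergent_series_0 [simp]: "convergent_series 0"
  and convergent_series_1 [simp]: "convergent_series 1"
  using convergent_series_cst[of 0] convergent_series_cst[of 1] by (simp_all add: cst_simps)

lemma convergent_series_y [simp]: "convergent_series y"
  by (rule convergent_seriesI[of 1 _ 1]) (auto simp: y_def fps_X_def)

lemma convergent_series_z [simp]: "convergent_series z"
  by (rule convergent_seriesI[of 1 _ 1]) (auto simp: z_def fps_X_def)

lemma convergent_series_add [simp]:
  assumes "convergent_series F" "convergent_series G"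
  shows "convergent_series (F + G)"
proof -
  obtain M R where F: "M \<ge> 0" "R > 0" "\<And>i j. norm (fps_nth (fps_nth F i) j) \<le> M * R ^ (i + j)"
    by (rule convergent_seriesE[OF assms(1)]) blast
  obtain N S where G: "N \<ge> 0" "S > 0" "\<And>i j. norm (fps_nth (fps_nth G i) j) \<le> N * S ^ (i + j)"
    by (rule convergent_seriesE[OF assms(2)]) blast
  show ?thesis
  proof (rule convergent_seriesI)
    show "max R S > 0" using F by simp
    fix i j
    have "norm (fps_nth (fps_nth (F + G) i) j) \<le> M * R ^ (i + j) + N * S ^ (i + j)"
      using norm_triangle_mono[OF F(3) G(3)] by simp
    also have "\<dots> \<le> M * max R S ^ (i + j) + N * max R S ^ (i + j)"
      using F G by (intro add_mono mult_left_mono power_mono) auto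
    finally show "norm (fps_nth (fps_nth (F + G) i) j) \<le> (M + N) * max R S ^ (i + j)"
      by (simp add: algebra_simps)
  qed
qed

text \<open>A coefficient of the product is a sum of \<open>(i + 1) (j + 1)\<close> terms of size at
  most \<open>M N T^(i + j)\<close>. Since \<open>n + 1 <= 2^n\<close>, doubling the rate
  \<open>T\<close> absorbs the number of terms.\<close>

lemma convergent_series_mult [simp]:
  assumes "convergent_series F" "convergent_series G"
  shows "convergent_series (F * G)"
proof -
  obtain M R where F: "M \<ge> 0" "R > 0" "\<And>i j. norm (fps_nth (fps_nth F i) j) \<le> M * R ^ (i + j)"
    by (rule convergent_seriesE[OF assms(1)]) blast
  obtain N S where G: "N \<ge> 0" "S > 0" "\<And>i j. norm (fps_nth (fps_nth G i) j) \<le> N * S ^ (i + j)"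
    by (rule convergent_seriesE[OF assms(2)]) blast
  define T where "T = max R S"
  have T: "T > 0" "R \<le> T" "S \<le> T" using F by (auto simp: T_def)
  show ?thesis
  proof (rule convergent_seriesI)
    show "2 * T > 0" using T by simp
    fix i j
    have term_le: "norm (fps_nth (fps_nth F k) l * fps_nth (fps_nth G (i - k)) (j - l)) \<le> M * N * T ^ (i + j)"
      if "k \<le> i" "l \<le> j" for k l
    proof -
      have "norm (fps_nth (fps_nth F k) l * fps_nth (fps_nth G (i - k)) (j - l))
          \<le> (M * R ^ (k + l)) * (N * S ^ ((i - k) + (j - l)))"
        unfolding norm_mult using F G by (intro mult_mono) auto
      also have "\<dots> \<le> (M * T ^ (k + l)) * (N * T ^ ((i - k) + (j - l)))"
        using F G T by (intro mult_mono mult_left_mono power_mono mult_nonneg_nonneg) auto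
      also have "\<dots> = M * N * T ^ ((k + l) + ((i - k) + (j - l)))"
        by (simp add: power_add)
      also have "(k + l) + ((i - k) + (j - l)) = i + j"
        using that by simp
      finally show ?thesis .
    qed
    have nat_le: "real (Suc n) \<le> 2 ^ n" for n
      by (induction n) auto
    have "fps_nth (fps_nth (F * G) i) j
        = (\<Sum>k=0..i. \<Sum>l=0..j. fps_nth (fps_nth F k) l * fps_nth (fps_nth G (i - k)) (j - l))"
      by (simp add: fps_mult_nth fps_sum_nth)
    also have "norm \<dots> \<le> (\<Sum>k=0..i. \<Sum>l=0..j. M * N * T ^ (i + j))"
      by (intro sum_norm_le term_le) auto
    also have "\<dots> = real (Suc i) * real (Suc j) * (M * N * T ^ (i + j))"
      by simp
    also have "\<dots> \<le> 2 ^ i * 2 ^ j * (M * N * T ^ (i + j))"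
      using F G T by (intro mult_right_mono mult_mono nat_le) auto
    finally show "norm (fps_nth (fps_nth (F * G) i) j) \<le> (M * N) * (2 * T) ^ (i + j)"
      by (simp add: power_add power_mult_distrib mult_ac)
  qed
qed

lemma convergent_series_uminus [simp]: "convergent_series F \<Longrightarrow> convergent_series (- F)"
  using convergent_series_mult[OF convergent_series_cst[of "- 1"], of F] by (simp add: cst_simps)

lemma convergent_series_diff [simp]:
  "convergent_series F \<Longrightarrow> convergent_series G \<Longrightarrow> convergent_series (F - G)"
  using convergent_series_add[of F "- G"] by simp

lemma convergent_series_power [simp]: "convergent_series F \<Longrightarrow> convergent_series (F ^ n)"
  by (induction n) auto

lemma convergent_series_subseries:
  assumes "convergent_series F"
    and "\<And>i j. fps_nth (fps_nth G i) j = 0 \<or> fps_nth (fps_nth G i) j = fps_nth (fps_nth F (i + k)) (j + l)"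
  shows "convergent_series G"
proof -
  obtain M R where F: "M \<ge> 0" "R > 0" "\<And>i j. norm (fps_nth (fps_nth F i) j) \<le> M * R ^ (i + j)"
    by (rule convergent_seriesE[OF assms(1)]) blast
  show ?thesis
  proof (rule convergent_seriesI)
    show "R > 0" by fact
    fix i j
    show "norm (fps_nth (fps_nth G i) j) \<le> M * R ^ (k + l) * R ^ (i + j)"
      using assms(2)[of i j]
    proof
      assume "fps_nth (fps_nth G i) j = 0"
      thus ?thesis using F by simp
    next
      assume "fps_nth (fps_nth G i) j = fps_nth (fps_nth F (i + k)) (j + l)"
      thus ?thesis using F(3)[of "i + k" "j + l"] by (simp add: power_add mult_ac)
    qed
  qed
qed

text \<open>The exponents \<open>(i, j)\<close> are split into the box \<open>i < k\<close>,
  \<open>j < l\<close>, the range \<open>i >= k\<close>, and the range \<open>i < k\<close>,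
  \<open>j >= l\<close>. With \<open>y^k\<close> and \<open>z^l\<close> in an ideal,
  \<open>F\<close> becomes congruent to a polynomial.\<close>

lemma convergent_series_decompose:
  assumes "convergent_series F"
  obtains G H where "convergent_series G" "convergent_series H"
    "F = (\<Sum>i<k. \<Sum>j<l. cst (fps_nth (fps_nth F i) j) * (y ^ i * z ^ j)) + y ^ k * G + z ^ l * H"
proof
  define G where "G = fps_shift k F"
  \<comment> \<open>Restricted to \<open>i < k\<close>, so that no monomial is counted in both
    remainders.\<close>
  define H where "H = Abs_fps (\<lambda>i. if i < k then fps_shift l (fps_nth F i) else 0)"
  show "convergent_series G"
    by (rule convergent_series_subseries[OF assms, of _ k 0]) (simp add: G_def)
  show "convergent_series H"
    by (rule convergent_series_subseries[OF assms, of _ 0 l]) (simp add: H_def)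
  show "F = (\<Sum>i<k. \<Sum>j<l. cst (fps_nth (fps_nth F i) j) * (y ^ i * z ^ j)) + y ^ k * G + z ^ l * H"
  proof (rule fps_ext, rule fps_ext)
    fix a b
    have mon: "fps_nth (fps_nth (y ^ i * z ^ j) a) b = (if a = i \<and> b = j then 1 else 0)" for i j
      using z_power_nth[of j 1 "a - i" b]
      by (auto simp: y_power_nth split: if_splits)
    have "fps_nth (fps_nth (\<Sum>i<k. \<Sum>j<l. cst (fps_nth (fps_nth F i) j) * (y ^ i * z ^ j)) a) b
        = (\<Sum>i<k. \<Sum>j<l. if a = i \<and> b = j then fps_nth (fps_nth F i) j else 0)"
      by (simp add: fps_sum_nth cst_nth mon if_distrib cong: if_cong)
    also have "\<dots> = (\<Sum>i<k. if a = i then (\<Sum>j<l. if b = j then fps_nth (fps_nth F i) j else 0) else 0)"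
      by (intro sum.cong refl) (auto)
    also have "\<dots> = (if a < k \<and> b < l then fps_nth (fps_nth F a) b else 0)"
      by simp
    finally show "fps_nth (fps_nth F a) b = fps_nth (fps_nth
        ((\<Sum>i<k. \<Sum>j<l. cst (fps_nth (fps_nth F i) j) * (y ^ i * z ^ j)) + y ^ k * G + z ^ l * H) a) b"
      by (simp add: y_power_nth z_power_nth G_def H_def)
  qed
qed

text \<open>Geometric series: \<open>y - r = -r (1 - y/r)\<close>, and the inverse of the second
  factor has coefficients \<open>r^(-i)\<close>, hence it converges.\<close>

lemma unit_y_minus_cst:
  assumes "r \<noteq> 0"
  obtains U where "convergent_series U" "U * (y - cst r) = 1"
proof
  let ?U = "- cst (inverse r) * Abs_fps (\<lambda>i. fps_const (inverse r ^ i))"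
  have "convergent_series (Abs_fps (\<lambda>i. fps_const (inverse r ^ i)))"
    using assms
    by (intro convergent_seriesI[of "norm (inverse r)" _ 1]) (auto simp: norm_power)
  thus "convergent_series ?U" by simp
  have "Abs_fps (\<lambda>i. fps_const (inverse r ^ i)) * (1 - cst (inverse r) * y) = 1"
    using assms by (intro fps_ext) (auto simp: y_def cst_def algebra_simps fps_eq_iff power_Suc2 gr0_conv_Suc split: if_splits)
  moreover have "y - cst r = - cst r * (1 - cst (inverse r) * y)"
    using cst_inverse[OF assms] by (simp add: algebra_simps)
  ultimately show "?U * (y - cst r) = 1"
    using cst_inverse[OF assms]
    by (metis (no_types, lifting) mult.assoc mult.commute mult_minus_left mult_minus_right minus_minus mult_1)
qed

lemma unit_z_minus_cst:
  assumes "r \<noteq> 0"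
  obtains U where "convergent_series U" "U * (z - cst r) = 1"
proof
  let ?U = "- cst (inverse r) * fps_const (Abs_fps (\<lambda>j. inverse r ^ j))"
  have "convergent_series (fps_const (Abs_fps (\<lambda>j. inverse r ^ j)))"
    using assms
    by (intro convergent_seriesI[of "norm (inverse r)" _ 1]) (auto simp: norm_power)
  thus "convergent_series ?U" by simp
  have "Abs_fps (\<lambda>j. inverse r ^ j) * (1 - fps_const (inverse r) * fps_X) = 1"
    using assms by (intro fps_ext) (auto simp: algebra_simps fps_eq_iff power_Suc2 gr0_conv_Suc split: if_splits)
  hence "fps_const (Abs_fps (\<lambda>j. inverse r ^ j)) * (1 - cst (inverse r) * z) = 1"
    by (metis cst_def z_def fps_const_1_eq_1 fps_const_mult fps_const_sub)
  moreover have "z - cst r = - cst r * (1 - cst (inverse r) * z)"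
    using cst_inverse[OF assms] by (simp add: algebra_simps)
  ultimately show "?U * (z - cst r) = 1"
    using cst_inverse[OF assms]
    by (metis (no_types, lifting) mult.assoc mult.commute mult_minus_left mult_minus_right minus_minus mult_1)
qed

section \<open>Polynomials as germs\<close>

lemma germ_nth: "fps_nth (fps_nth (germ p) i) j = poly.coeff (poly.coeff p i) j"
  by (simp add: germ_def coeff_map_poly)

lemma germ_simps:
  "germ 0 = 0" "germ (p + q) = germ p + germ q" "germ (p - q) = germ p - germ q" "germ (- p) = - germ p"
  "germ (p * q) = germ p * germ q" "germ (K c) = cst c" "germ Y = y" "germ Z = z"
proof -
  show "germ (p * q) = germ p * germ q"
    by (intro fps_ext) (simp add: germ_nth coeff_mult fps_mult_nth fps_sum_nth coeff_sum atLeast0AtMost)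
  show "germ (K c) = cst c"
    by (intro fps_ext) (simp add: germ_nth K_def cst_def coeff_pCons split: nat.splits)
  show "germ Y = y"
    by (intro fps_ext) (auto simp: germ_nth Y_def y_def coeff_pCons fps_X_def split: nat.splits)
  show "germ Z = z"
    by (intro fps_ext) (auto simp: germ_nth Z_def z_def coeff_pCons fps_X_def split: nat.splits)
qed (auto intro!: fps_ext simp: germ_nth)

lemma germ_power: "germ (p ^ n) = germ p ^ n"
proof (induction n)
  case 0
  show ?case using germ_simps(6)[of 1] by (simp add: K_def cst_simps one_pCons)
qed (simp add: germ_simps)


section \<open>Ideals of germs and spanning sets\<close>

interpretation series: vector_space "\<lambda>c F. cst c * F"
  by standard (simp_all add: cst_simps algebra_simps)

text \<open>Gaussian elimination by induction on the equations: a pivot unknown is eliminated with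
  one equation, the smaller system is solved, and the pivot is recovered by back
  substitution.\<close>

lemma underdetermined_system:
  fixes M :: "'i \<Rightarrow> 'j \<Rightarrow> 'k::field"
  assumes "finite I" "finite J" "card I < card J"
  shows "\<exists>x. (\<exists>j\<in>J. x j \<noteq> 0) \<and> (\<forall>i\<in>I. (\<Sum>j\<in>J. M i j * x j) = 0)"
  using assms
proof (induction I arbitrary: J M rule: finite_induct)
  case empty
  then obtain j where "j \<in> J" by fastforce
  thus ?case by (intro exI[of _ "\<lambda>_. 1"]) auto
next
  case (insert i I)
  show ?case
  proof (cases "\<forall>j\<in>J. M i j = 0")
    case True
    have "\<exists>x. (\<exists>j\<in>J. x j \<noteq> 0) \<and> (\<forall>i\<in>I. (\<Sum>j\<in>J. M i j * x j) = 0)"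
      using insert by (intro insert.IH) auto
    thus ?thesis using True by auto
  next
    case False
    then obtain p where p: "p \<in> J" "M i p \<noteq> 0" by blast
    define J' where "J' = J - {p}"
    have J: "J = insert p J'" "p \<notin> J'" "finite J'"
      using p insert.prems by (auto simp: J'_def)
    have "\<exists>x. (\<exists>j\<in>J'. x j \<noteq> 0) \<and> (\<forall>k\<in>I. (\<Sum>j\<in>J'. (M k j - M k p * M i j / M i p) * x j) = 0)"
      using insert p by (intro insert.IH) (auto simp: J)
    then obtain x where x: "\<exists>j\<in>J'. x j \<noteq> 0"
      and x0: "\<And>k. k \<in> I \<Longrightarrow> (\<Sum>j\<in>J'. (M k j - M k p * M i j / M i p) * x j) = 0"
      by blast
    define s where "s = (\<Sum>j\<in>J'. M i j * x j)"
    \<comment> \<open>The value of the pivot unknown that equation \<open>i\<close> forces.\<close>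
    define x' where "x' = x(p := - s / M i p)"
    have sum_x': "(\<Sum>j\<in>J. M k j * x' j) = (\<Sum>j\<in>J'. M k j * x j) - M k p * s / M i p" for k
    proof -
      have "(\<Sum>j\<in>J'. M k j * x' j) = (\<Sum>j\<in>J'. M k j * x j)"
        using J by (intro sum.cong) (auto simp: x'_def)
      thus ?thesis using J by (simp add: x'_def)
    qed
    have "(\<Sum>j\<in>J. M k j * x' j) = 0" if "k \<in> insert i I" for k
    proof (cases "k = i")
      case True
      thus ?thesis using p by (simp add: sum_x' flip: s_def)
    next
      case False
      hence "0 = (\<Sum>j\<in>J'. (M k j - M k p * M i j / M i p) * x j)"
        using that x0 by simp
      also have "\<dots> = (\<Sum>j\<in>J'. M k j * x j) - M k p * s / M i p"
        by (simp add: s_def algebra_simps sum_subtractf sum_distrib_left sum_divide_distrib)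
      finally show ?thesis by (simp add: sum_x')
    qed
    moreover have "\<exists>j\<in>J. x' j \<noteq> 0"
      using x J by (auto simp: x'_def)
    ultimately show ?thesis by blast
  qed
qed

definition series_poly :: "complex fps fps \<Rightarrow> complex poly \<Rightarrow> complex fps fps" where
  "series_poly t p = poly (map_poly cst p) t"

lemma series_poly_add: "series_poly t (p + q) = series_poly t p + series_poly t q"
proof -
  have "map_poly cst (p + q) = map_poly cst p + map_poly cst q"
    by (intro poly_eqI) (simp add: coeff_map_poly cst_simps)
  thus ?thesis by (simp add: series_poly_def)
qed

lemma series_poly_smult: "series_poly t (Polynomial.smult c p) = cst c * series_poly t p"
proof -
  have "map_poly cst (Polynomial.smult c p) = Polynomial.smult (cst c) (map_poly cst p)"
    by (intro poly_eqI) (simp add: coeff_map_poly cst_simps)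
  thus ?thesis by (simp add: series_poly_def)
qed

lemma series_poly_pCons: "series_poly t (pCons c p) = cst c + t * series_poly t p"
  by (simp add: series_poly_def map_poly_pCons cst_simps)

lemma series_poly_monom: "series_poly t (Polynomial.monom c n) = cst c * t ^ n"
  by (simp add: series_poly_def map_poly_monom cst_simps poly_monom)

lemma series_poly_sum: "series_poly t (sum f A) = (\<Sum>a\<in>A. series_poly t (f a))"
  by (induction A rule: infinite_finite_induct) (auto simp: series_poly_add, auto simp: series_poly_def)

text \<open>The local ring is a subset of the type of formal series, not a type of its own; so the
  ideal is a set of convergent series that absorbs only convergent multipliers.\<close>

locale series_ideal =
  fixes I :: "complex fps fps set"
  assumes zero: "0 \<in> I"
    and add: "F \<in> I \<Longrightarrow> G \<in> I \<Longrightarrow> F + G \<in> I"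
    and mult: "convergent_series P \<Longrightarrow> F \<in> I \<Longrightarrow> P * F \<in> I"
    and convergent: "F \<in> I \<Longrightarrow> convergent_series F"
begin

lemma subspace: "series.subspace I"
  by (auto simp: series.subspace_def zero add mult)

lemma span_Un_mult_closed:
  assumes "convergent_series t" "\<And>b. b \<in> B \<Longrightarrow> t * b \<in> series.span (B \<union> I)"
    and "F \<in> series.span (B \<union> I)"
  shows "t * F \<in> series.span (B \<union> I)"
proof -
  have "series.subspace {F. t * F \<in> series.span (B \<union> I)}"
    unfolding series.subspace_def
    by (auto simp: distrib_left mult.left_commute[of t]
        intro: series.span_zero series.span_add series.span_scale)
  from series.span_induct[OF assms(3) this] show ?thesis
    using assms mult series.span_base[of _ "B \<union> I"] by auto
qed

text \<open>Modulo \<open>I\<close>, the \<open>card B + 1\<close> powers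
  \<open>1, ..., t^(card B)\<close> are combinations of \<open>card B\<close> elements, hence
  linearly dependent; the dependency gives the coefficients of \<open>p\<close>. Counting equations
  avoids any independence assumption on \<open>B\<close>.\<close>

lemma algebraic_mod:
  assumes "finite B" "\<And>n. t ^ n \<in> series.span (B \<union> I)"
  obtains p where "p \<noteq> 0" "series_poly t p \<in> I"
proof -
  have "\<exists>u. t ^ n - (\<Sum>b\<in>B. cst (u b) * b) \<in> I" for n
  proof -
    have span_I: "series.span I = I"
      using subspace by (simp add: series.span_eq_iff)
    have "t ^ n \<in> {v + w | v w. v \<in> series.span B \<and> w \<in> I}"
      using assms(2)[of n] unfolding series.span_Un span_I .
    then obtain v w where vw: "t ^ n = v + w" "v \<in> series.span B" "w \<in> I" by blast
    then obtain u where "v = (\<Sum>b\<in>B. cst (u b) * b)"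
      unfolding series.span_finite[OF assms(1)] by blast
    with vw show ?thesis by (intro exI[of _ u]) simp
  qed
  hence "\<forall>n. \<exists>u. t ^ n - (\<Sum>b\<in>B. cst (u b) * b) \<in> I" by blast
  from choice[OF this] obtain u where u: "\<And>n. t ^ n - (\<Sum>b\<in>B. cst (u n b) * b) \<in> I"
    by blast
  define w where "w n = t ^ n - (\<Sum>b\<in>B. cst (u n b) * b)" for n
  have uw: "\<And>n. t ^ n = (\<Sum>b\<in>B. cst (u n b) * b) + w n" "\<And>n. w n \<in> I"
    using u by (simp_all add: w_def)
  \<comment> \<open>One equation per element of \<open>B\<close>, one unknown per power of
    \<open>t\<close>: there is one more unknown than equations.\<close>
  obtain x where x: "\<exists>j\<in>{..card B}. x j \<noteq> 0" "\<And>b. b \<in> B \<Longrightarrow> (\<Sum>j\<le>card B. u j b * x j) = 0"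
    using underdetermined_system[of B "{..card B}" "\<lambda>b j. u j b"] assms(1) by auto
  define p where "p = (\<Sum>j\<le>card B. Polynomial.monom (x j) j)"
  have "poly.coeff p j = x j" if "j \<le> card B" for j
    using that by (simp add: p_def coeff_sum sum.delta)
  hence "p \<noteq> 0" using x(1) by force
  have "series_poly t p = (\<Sum>j\<le>card B. cst (x j) * t ^ j)"
    by (simp add: p_def series_poly_sum series_poly_monom)
  also have "\<dots> = (\<Sum>j\<le>card B. \<Sum>b\<in>B. cst (u j b * x j) * b) + (\<Sum>j\<le>card B. cst (x j) * w j)"
    by (simp add: uw(1) distrib_left sum.distrib sum_distrib_left cst_simps mult_ac)
  also have "(\<Sum>j\<le>card B. \<Sum>b\<in>B. cst (u j b * x j) * b) = (\<Sum>b\<in>B. cst (\<Sum>j\<le>card B. u j b * x j) * b)"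
    by (subst sum.swap, intro sum.cong refl) (rule series.scale_sum_left[symmetric])
  also have "\<dots> = 0"
    using x(2) by (simp add: cst_simps)
  finally have "series_poly t p = (\<Sum>j\<le>card B. cst (x j) * w j)" by simp
  hence "series_poly t p \<in> I"
    using series.subspace_sum[OF subspace, of "{..card B}" "\<lambda>j. cst (x j) * w j"]
    by (simp add: mult uw)
  with \<open>p \<noteq> 0\<close> show thesis by (rule that)
qed

text \<open>
  All roots of \<open>p\<close> other than \<open>0\<close> give units, so only the power of \<open>t\<close> dividing \<open>p\<close> survives.
\<close>

lemma power_mem:
  assumes t: "convergent_series t"
    and unit: "\<And>r. r \<noteq> 0 \<Longrightarrow> \<exists>U. convergent_series U \<and> U * (t - cst r) = 1"
  shows "p \<noteq> 0 \<Longrightarrow> t ^ j * series_poly t p \<in> I \<Longrightarrow> \<exists>k. t ^ k \<in> I"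
proof (induction "Polynomial.degree p" arbitrary: p j)
  case 0
  then obtain c where c: "p = [:c:]" by (metis degree_eq_zeroE)
  hence "c \<noteq> 0" using 0 by auto
  have "cst (inverse c) * (t ^ j * series_poly t p) \<in> I"
    by (rule mult) (use 0 in auto)
  also have "series_poly t p = cst c"
    by (simp add: c series_poly_pCons) (simp add: series_poly_def)
  also have "cst (inverse c) * (t ^ j * cst c) = (cst (inverse c) * cst c) * t ^ j"
    by (simp only: mult_ac)
  also have "\<dots> = t ^ j"
    by (simp only: cst_inverse[OF \<open>c \<noteq> 0\<close>] mult_1)
  finally show ?case by blast
next
  case (Suc d)
  have "\<not> constant (poly p)"
    using Suc by (simp add: constant_degree)
  then obtain r where "poly p r = 0"
    using fundamental_theorem_of_algebra by blast
  then obtain q where q: "p = [:- r, 1:] * q"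
    unfolding poly_eq_0_iff_dvd by (elim dvdE)
  have "q \<noteq> 0" using q Suc by auto
  have deg: "d = Polynomial.degree q"
    using Suc.hyps(2) \<open>q \<noteq> 0\<close> degree_mult_eq[of "[:- r, 1:]" q] unfolding q by simp
  have "series_poly t p = (t - cst r) * series_poly t q"
  proof -
    have "p = pCons 0 q + Polynomial.smult (- r) q" by (simp add: q)
    thus ?thesis
      by (simp only: series_poly_add series_poly_smult series_poly_pCons) (simp add: cst_simps algebra_simps)
  qed
  hence mem: "t ^ j * ((t - cst r) * series_poly t q) \<in> I"
    using Suc by simp
  \<comment> \<open>The exponent \<open>j\<close> collects the factors \<open>t\<close> split off so
    far: a root \<open>0\<close> raises it, while any other root is cancelled by an inverse.\<close>
  show ?case
  proof (cases "r = 0")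
    case True
    hence "t ^ Suc j * series_poly t q \<in> I"
      using mem by (simp add: cst_simps mult_ac)
    from Suc.hyps(1)[OF deg \<open>q \<noteq> 0\<close> this] show ?thesis .
  next
    case False
    then obtain U where U: "convergent_series U" "U * (t - cst r) = 1"
      using unit by blast
    have "U * (t ^ j * ((t - cst r) * series_poly t q)) \<in> I"
      using U mem mult by blast
    also have "U * (t ^ j * ((t - cst r) * series_poly t q)) = U * (t - cst r) * (t ^ j * series_poly t q)"
      by (simp only: mult_ac)
    finally have "t ^ j * series_poly t q \<in> I"
      by (simp add: U)
    from Suc.hyps(1)[OF deg \<open>q \<noteq> 0\<close> this] show ?thesis .
  qed
qed

text \<open>This reduces spanning by a finite set to finitely many products: stability under
  \<open>y\<close> and \<open>z\<close> puts all monomials in the span, and the algebraic relations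
  for \<open>y\<close> and \<open>z\<close> then dispose of the tails.\<close>

lemma convergent_series_in_span:
  assumes B: "finite B" "1 \<in> series.span (B \<union> I)"
    and y: "\<And>b. b \<in> B \<Longrightarrow> y * b \<in> series.span (B \<union> I)"
    and z: "\<And>b. b \<in> B \<Longrightarrow> z * b \<in> series.span (B \<union> I)"
    and F: "convergent_series F"
  shows "F \<in> series.span (B \<union> I)"
proof -
  have z_power: "z ^ j \<in> series.span (B \<union> I)" for j
    by (induction j) (simp_all add: B span_Un_mult_closed z)
  have monomial: "y ^ i * z ^ j \<in> series.span (B \<union> I)" for i j
    by (induction i) (simp_all add: z_power span_Un_mult_closed y mult.assoc)
  have unit_y: "\<exists>U. convergent_series U \<and> U * (y - cst r) = 1" if "r \<noteq> 0" for r
    by (rule unit_y_minus_cst[OF that]) blast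
  have unit_z: "\<exists>U. convergent_series U \<and> U * (z - cst r) = 1" if "r \<noteq> 0" for r
    by (rule unit_z_minus_cst[OF that]) blast
  obtain p where "p \<noteq> 0" "series_poly y p \<in> I"
    using algebraic_mod[OF B(1)] monomial[of _ 0] by auto
  then obtain k where k: "y ^ k \<in> I"
    using power_mem[OF convergent_series_y unit_y, of p 0] by auto
  obtain p where "p \<noteq> 0" "series_poly z p \<in> I"
    using algebraic_mod[OF B(1) z_power] by auto
  then obtain l where l: "z ^ l \<in> I"
    using power_mem[OF convergent_series_z unit_z, of p 0] by auto
  obtain G H where GH: "convergent_series G" "convergent_series H"
    and F_eq: "F = (\<Sum>i<k. \<Sum>j<l. cst (fps_nth (fps_nth F i) j) * (y ^ i * z ^ j)) + y ^ k * G + z ^ l * H"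
    by (rule convergent_series_decompose[OF F, of l k]) (rule that)
  have "y ^ k * G \<in> I" "z ^ l * H \<in> I"
    using mult[OF GH(1) k] mult[OF GH(2) l] by (simp_all add: mult.commute)
  thus ?thesis
    by (subst F_eq) (intro series.span_add series.span_sum series.span_scale monomial; blast intro: series.span_base)
qed

end

text \<open>The explicit form of the ideal with two generators, on which functionals can be
  evaluated; \<open>genideal_eq_series_ideal_of\<close> matches it with the generated ideal in
  \<open>quotient_ring\<close>.\<close>

definition series_ideal_of :: "complex fps fps \<Rightarrow> complex fps fps \<Rightarrow> complex fps fps set" where
  "series_ideal_of F G = {P * F + Q * G | P Q. convergent_series P \<and> convergent_series Q}"

lemma series_ideal_of_mem:
  "convergent_series P \<Longrightarrow> convergent_series Q \<Longrightarrow> P * F + Q * G \<in> series_ideal_of F G"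
  unfolding series_ideal_of_def by blast

lemma series_ideal_series_ideal_of:
  assumes "convergent_series F" "convergent_series G"
  shows "series_ideal (series_ideal_of F G)"
proof
  show "0 \<in> series_ideal_of F G"
    using series_ideal_of_mem[of 0 0 F G] by simp
next
  fix A B assume "A \<in> series_ideal_of F G" "B \<in> series_ideal_of F G"
  then obtain P Q P' Q' where *: "convergent_series P" "convergent_series Q"
      "convergent_series P'" "convergent_series Q'" "A = P * F + Q * G" "B = P' * F + Q' * G"
    unfolding series_ideal_of_def by blast
  have "A + B = (P + P') * F + (Q + Q') * G" by (simp add: * algebra_simps)
  with * show "A + B \<in> series_ideal_of F G" by (simp add: series_ideal_of_mem)
next
  fix R A assume "convergent_series R" "A \<in> series_ideal_of F G"
  then obtain P Q where *: "convergent_series P" "convergent_series Q" "A = P * F + Q * G"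
    unfolding series_ideal_of_def by blast
  have "R * A = (R * P) * F + (R * Q) * G" by (simp add: * algebra_simps)
  with * \<open>convergent_series R\<close> show "R * A \<in> series_ideal_of F G" by (simp add: series_ideal_of_mem)
qed (use assms in \<open>auto simp: series_ideal_of_def\<close>)


section \<open>Dimension of the local quotient\<close>

lemma local_ring_simps:
  "carrier local_ring = {F. convergent_series F}" "x \<otimes>\<^bsub>local_ring\<^esub> x' = x * x'"
  "x \<oplus>\<^bsub>local_ring\<^esub> x' = x + x'" "\<one>\<^bsub>local_ring\<^esub> = 1" "\<zero>\<^bsub>local_ring\<^esub> = 0"
  by (simp_all add: local_ring_def)

lemma local_ring_cring: "cring local_ring"
proof (rule cringI)
  show "abelian_group local_ring"
  proof (rule abelian_groupI)
    fix F assume "F \<in> carrier local_ring"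
    thus "\<exists>G\<in>carrier local_ring. G \<oplus>\<^bsub>local_ring\<^esub> F = \<zero>\<^bsub>local_ring\<^esub>"
      by (intro bexI[of _ "- F"]) (simp_all add: local_ring_simps)
  qed (simp_all add: local_ring_simps algebra_simps)
  show "comm_monoid local_ring"
    by (rule comm_monoidI) (simp_all add: local_ring_simps algebra_simps)
qed (simp add: local_ring_simps algebra_simps)

interpretation local_ring: cring local_ring
  by (rule local_ring_cring)

lemma local_ring_uminus: "convergent_series F \<Longrightarrow> \<ominus>\<^bsub>local_ring\<^esub> F = - F"
  by (rule local_ring.minus_equality) (simp_all add: local_ring_simps)

lemma subfield_constants: "subfield (range cst) local_ring"
proof (rule local_ring.subfieldI)
  show "subcring (range cst) local_ring"
  proof (rule local_ring.subcringI')
    show "subring (range cst) local_ring"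
    proof (rule local_ring.subringI)
      show "\<one>\<^bsub>local_ring\<^esub> \<in> range cst"
        using cst_simps(2) by (metis local_ring_simps(4) rangeI)
    qed (auto simp: local_ring_simps local_ring_uminus simp flip: cst_simps)
  qed
  show "Units (local_ring\<lparr>carrier := range cst\<rparr>) = range cst - {\<zero>\<^bsub>local_ring\<^esub>}"
  proof (intro equalityI subsetI)
    fix u assume "u \<in> Units (local_ring\<lparr>carrier := range cst\<rparr>)"
    thus "u \<in> range cst - {\<zero>\<^bsub>local_ring\<^esub>}"
      by (auto simp: Units_def local_ring_simps)
  next
    fix u assume "u \<in> range cst - {\<zero>\<^bsub>local_ring\<^esub>}"
    then obtain c where c: "u = cst c" "cst c \<noteq> 0"
      by (auto simp: local_ring_simps)
    hence "c \<noteq> 0" by (auto simp: cst_simps)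
    with c show "u \<in> Units (local_ring\<lparr>carrier := range cst\<rparr>)"
      using c cst_inverse[of c] by (auto simp: Units_def local_ring_simps mult.commute)
  qed
qed

text \<open>Properness keeps the quotient nonzero, so that the constants still form a field there
  and dimensions over them make sense.\<close>

locale proper_series_ideal = series_ideal +
  assumes one: "1 \<notin> I"
begin

lemma span_I: "series.span I = I"
  using subspace by (simp add: series.span_eq_iff)

lemma mult_right: "F \<in> I \<Longrightarrow> convergent_series P \<Longrightarrow> F * P \<in> I"
  by (subst mult.commute) (rule mult)

sublocale quot: ideal I local_ring
proof (rule idealI)
  show "subgroup I (add_monoid local_ring)"
  proof (rule local_ring.add.subgroupI)
    fix F assume "F \<in> I"
    thus "\<ominus>\<^bsub>local_ring\<^esub> F \<in> I"
      using mult[of "- 1" F] by (simp add: local_ring_uminus convergent)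
  qed (use zero add convergent in \<open>auto simp: local_ring_simps\<close>)
qed (auto simp: local_ring_simps local_ring.ring_axioms mult mult_right)

abbreviation Q :: "complex fps fps set ring" where "Q \<equiv> local_ring Quot I"

abbreviation h :: "complex fps fps \<Rightarrow> complex fps fps set" where "h \<equiv> (+>\<^bsub>local_ring\<^esub>) I"

sublocale Q: ring Q
  by (rule quot.quotient_is_ring)

sublocale h: ring_hom_ring local_ring Q h
  by (rule quot.rcos_ring_hom_ring)

lemma h_eq_iff:
  assumes "convergent_series F" "convergent_series G"
  shows "h F = h G \<longleftrightarrow> F - G \<in> I"
proof
  assume "h F = h G"
  hence "F \<in> h G"
    using quot.a_rcos_self[of F] assms by (simp add: local_ring_simps)
  thus "F - G \<in> I"
    by (auto simp: a_r_coset_def r_coset_def local_ring_simps)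
next
  assume "F - G \<in> I"
  hence "F \<in> h G"
    by (auto simp: a_r_coset_def r_coset_def local_ring_simps intro!: bexI[of _ "F - G"])
  thus "h F = h G"
    using local_ring.a_repr_independence[of F I G] quot.a_subgroup assms by (simp add: local_ring_simps)
qed

lemma carrier_Q: "carrier Q = h ` carrier local_ring"
  unfolding FactRing_def A_RCOSETS_def' by (simp only: partial_object.simps) blast

lemma subfield_Q: "subfield (h ` range cst) Q"
proof (rule h.img_is_subfield(2)[OF subfield_constants])
  show "\<one>\<^bsub>Q\<^esub> \<noteq> \<zero>\<^bsub>Q\<^esub>"
    using one quot.rcos_const_imp_mem[of 1] by (auto simp: FactRing_def local_ring_simps)
qed

text \<open>Bridge between the two notions of span: the list-based \<open>Span\<close> over the
  constants is a vector subspace, so it contains \<open>series.span\<close> of the same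
  elements.\<close>

lemma subspace_Span:
  assumes "set Us \<subseteq> carrier local_ring"
  shows "series.subspace (local_ring.Span (range cst) Us)"
proof -
  note sub = local_ring.Span_subgroup_props[OF subfield_constants assms]
  show ?thesis
    using sub local_ring.Span_smult_closed[OF subfield_constants assms]
    by (auto simp: series.subspace_def local_ring_simps)
qed

end

text \<open>Each new vector either lies in the span already built or raises the dimension by one, so
  dependent lists are allowed.\<close>

lemma (in ring) dimension_Span_le:
  assumes "subfield S R" "set Us \<subseteq> carrier R"
  shows "\<exists>n\<le>length Us. dimension n S (Span S Us)"
  using assms(2)
proof (induction Us)
  case (Cons u Us)
  then obtain n where n: "n \<le> length Us" "dimension n S (Span S Us)" by auto
  show ?case
  proof (cases "u \<in> Span S Us")
    case True
    hence "Span S (u # Us) = Span S Us"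
      using mono_Span_subset[OF assms(1), of "u # Us" Us] mono_Span[OF assms(1), of Us u]
        Span_base_incl[OF assms(1), of Us] Cons.prems by auto
    thus ?thesis using n by (intro exI[of _ n]) (simp del: Span.simps)
  next
    case False
    hence "dimension (Suc n) S (Span S (u # Us))"
      using Suc_dim[of u "Span S Us" n S] n Cons.prems by simp
    thus ?thesis using n by auto
  qed
qed auto

context proper_series_ideal
begin

lemma dim_le:
  assumes "set Us \<subseteq> carrier local_ring"
    and span: "\<And>F. convergent_series F \<Longrightarrow> F \<in> series.span (set Us \<union> I)"
  shows "Q.finite_dimension (h ` range cst) (carrier Q) \<and> Q.dim (h ` range cst) (carrier Q) \<le> length Us"
proof -
  have "h F \<in> h ` local_ring.Span (range cst) Us" if F: "convergent_series F" for F
  proof -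
    obtain s w where sw: "F = s + w" "s \<in> series.span (set Us)" "w \<in> I"
      using span[OF F] unfolding series.span_Un span_I by blast
    have "s \<in> local_ring.Span (range cst) Us"
      using sw(2) series.span_minimal[OF _ subspace_Span[OF assms(1)]]
        local_ring.Span_base_incl[OF subfield_constants assms(1)] by blast
    moreover have "convergent_series s"
      using convergent_series_diff[OF F convergent[OF sw(3)]] by (simp add: sw)
    hence "h F = h s"
      using F sw by (simp add: h_eq_iff)
    ultimately show ?thesis by blast
  qed
  hence "carrier Q = h ` local_ring.Span (range cst) Us"
    using local_ring.Span_subgroup_props(1)[OF subfield_constants assms(1)]
    by (auto simp: carrier_Q local_ring_simps)
  also have "\<dots> = Q.Span (h ` range cst) (map h Us)"
    by (rule h.Span_hom[symmetric]) (use assms(1) in \<open>auto simp: local_ring_simps\<close>)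
  finally have carrier: "carrier Q = Q.Span (h ` range cst) (map h Us)" .
  have "set (map h Us) \<subseteq> carrier Q"
    using assms(1) by auto
  from Q.dimension_Span_le[OF subfield_Q this] obtain n
    where n: "n \<le> length Us" "Q.dimension n (h ` range cst) (carrier Q)"
    by (auto simp: carrier)
  thus ?thesis
    using Q.finite_dimensionI Q.dimI[OF subfield_Q] by (auto simp: over_def)
qed

text \<open>The functionals vanish on \<open>I\<close> and descend to the quotient, where their
  matrix on the classes of the \<open>e k\<close> is triangular with nonzero diagonal. Thus
  \<open>e k\<close> is never in the span of its predecessors.\<close>

lemma le_dim:
  fixes \<phi> :: "nat \<Rightarrow> complex fps fps \<Rightarrow> complex" and e :: "nat \<Rightarrow> complex fps fps"
  assumes fin: "Q.finite_dimension (h ` range cst) (carrier Q)"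
    and add: "\<And>k F G. \<phi> k (F + G) = \<phi> k F + \<phi> k G"
    and scale: "\<And>k c F. \<phi> k (cst c * F) = c * \<phi> k F"
    and vanish: "\<And>k F. k < n \<Longrightarrow> F \<in> I \<Longrightarrow> \<phi> k F = 0"
    and e: "\<And>k. convergent_series (e k)"
    and triangular: "\<And>i k. k < n \<Longrightarrow> i < k \<Longrightarrow> \<phi> k (e i) = 0"
    and diagonal: "\<And>k. k < n \<Longrightarrow> \<phi> k (e k) \<noteq> 0"
  shows "n \<le> Q.dim (h ` range cst) (carrier Q)"
proof -
  \<comment> \<open>Reversed order, because independence of a list is extended at its head.\<close>
  have "Q.independent (h ` range cst) (map h (map e (rev [0..<k])))" if "k \<le> n" for k
    using that
  proof (induction k)
    case (Suc k)
    let ?Us = "map e (rev [0..<k])"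
    have Us: "set ?Us \<subseteq> carrier local_ring" using e by (auto simp: local_ring_simps)
    have "h (e k) \<notin> Q.Span (h ` range cst) (map h ?Us)"
    proof
      assume "h (e k) \<in> Q.Span (h ` range cst) (map h ?Us)"
      also have "\<dots> = h ` local_ring.Span (range cst) ?Us"
        by (rule h.Span_hom) (use Us in \<open>auto simp: local_ring_simps\<close>)
      finally obtain s where s: "s \<in> local_ring.Span (range cst) ?Us" "h (e k) = h s" by blast
      have "convergent_series s"
        using s local_ring.Span_subgroup_props(1)[OF subfield_constants Us] by (auto simp: local_ring_simps)
      hence "\<phi> k (e k - s) = 0"
        using s Suc e h_eq_iff vanish by simp
      moreover have "\<phi> k s = 0"
      proof -
        have Span: "\<forall>v\<in>local_ring.Span (range cst) Us. \<phi> k v = 0"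
          if "\<forall>u\<in>set Us. \<phi> k u = 0" for Us
          using that
        proof (induction Us)
          case Nil
          show ?case using scale[of k 0 0] by (simp add: cst_simps local_ring_simps)
        next
          case (Cons u Us)
          thus ?case
            by (auto simp: local_ring.line_extension_mem_iff local_ring_simps add scale)
        qed
        have "\<forall>u\<in>set ?Us. \<phi> k u = 0" using triangular[of k] Suc.prems by auto
        from Span[OF this] s(1) show ?thesis by blast
      qed
      moreover have "\<phi> k (e k) = \<phi> k (e k - s) + \<phi> k s"
        using add[of k "e k - s" s] by simp
      ultimately show False using diagonal Suc.prems by simp
    qed
    moreover have "h (e k) \<in> carrier Q" using e by (simp add: local_ring_simps)
    ultimately show ?case using Suc by (simp add: Q.li_Cons)
  qed auto
  hence ind: "Q.independent (h ` range cst) (map h (map e (rev [0..<n])))" by simp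
  have "Q.dimension (Q.dim (h ` range cst) (carrier Q)) (h ` range cst) (carrier Q)"
    using Q.finite_dimensionE[OF subfield_Q fin] by (simp add: over_def)
  moreover have "set (map h (map e (rev [0..<n]))) \<subseteq> carrier Q"
    using e by (auto simp: local_ring_simps)
  ultimately show ?thesis
    using Q.independent_length_le_dimension[OF subfield_Q _ ind] by fastforce
qed

end

section \<open>The intersection index of two polynomials vanishing at the origin\<close>

lemma genideal_eq_series_ideal_of:
  assumes "convergent_series F" "convergent_series G" "1 \<notin> series_ideal_of F G"
  shows "Idl\<^bsub>local_ring\<^esub> {F, G} = series_ideal_of F G"
proof
  interpret proper_series_ideal "series_ideal_of F G"
    using assms by (intro proper_series_ideal.intro series_ideal_series_ideal_of proper_series_ideal_axioms.intro)
  show "Idl\<^bsub>local_ring\<^esub> {F, G} \<subseteq> series_ideal_of F G"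
    using series_ideal_of_mem[of 1 0 F G] series_ideal_of_mem[of 0 1 F G]
    by (intro local_ring.genideal_minimal quot.is_ideal) auto
  have FG: "{F, G} \<subseteq> carrier local_ring" using assms by (simp add: local_ring_simps)
  interpret J: ideal "Idl\<^bsub>local_ring\<^esub> {F, G}" local_ring
    by (rule local_ring.genideal_ideal[OF FG])
  have "F \<in> Idl\<^bsub>local_ring\<^esub> {F, G}" "G \<in> Idl\<^bsub>local_ring\<^esub> {F, G}"
    using local_ring.genideal_self[OF FG] by auto
  thus "series_ideal_of F G \<subseteq> Idl\<^bsub>local_ring\<^esub> {F, G}"
    using J.I_l_closed J.a_closed unfolding series_ideal_of_def
    by (fastforce simp: local_ring_simps)
qed

lemma convergent_series_germ [simp]: "convergent_series (germ p)"
proof (induction p rule: pCons_induct)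
  case (pCons a p)
  have "convergent_series (fps_const (fps_of_poly a))"
  proof (induction a rule: pCons_induct)
    case (pCons c a)
    have "fps_const (fps_of_poly (pCons c a)) = cst c + z * fps_const (fps_of_poly a)"
      by (simp add: cst_def z_def fps_of_poly_pCons)
    with pCons show ?case by simp
  qed simp
  moreover have "germ (pCons a p) = fps_const (fps_of_poly a) + y * germ p"
    by (simp add: germ_def y_def map_poly_pCons fps_of_poly_pCons)
  ultimately show ?case using pCons by simp
qed (simp add: germ_simps)

lemma one_notin_series_ideal_of_germ:
  assumes "poly.coeff (poly.coeff f 0) 0 = 0" "poly.coeff (poly.coeff g 0) 0 = 0"
  shows "1 \<notin> series_ideal_of (germ f) (germ g)"
proof
  assume "1 \<in> series_ideal_of (germ f) (germ g)"
  then obtain P P' where "1 = P * germ f + P' * germ g"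
    unfolding series_ideal_of_def by blast
  from arg_cong[OF this, of "\<lambda>F. fps_nth (fps_nth F 0) 0"] show False
    using assms by (simp add: germ_nth)
qed

locale germs_at_origin =
  fixes f g :: "complex poly poly"
  assumes origin: "poly.coeff (poly.coeff f 0) 0 = 0" "poly.coeff (poly.coeff g 0) 0 = 0"
begin

sublocale proper_series_ideal "series_ideal_of (germ f) (germ g)"
  using origin by (intro proper_series_ideal.intro series_ideal_series_ideal_of
      proper_series_ideal_axioms.intro one_notin_series_ideal_of_germ) auto

lemma intersection_index_eq:
  "intersection_index f g =
     (if Q.finite_dimension (h ` range cst) (carrier Q) then enat (Q.dim (h ` range cst) (carrier Q)) else \<infinity>)"
proof -
  have "quotient_scalars f g = h ` range cst"
    by (auto simp: quotient_scalars_def germ_simps one_notin_series_ideal_of_germ origin genideal_eq_series_ideal_of)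
  thus ?thesis
    by (simp add: intersection_index_def quotient_ring_def Let_def one_notin_series_ideal_of_germ
        origin genideal_eq_series_ideal_of)
qed

lemma intersection_index_le:
  assumes "set Us \<subseteq> carrier local_ring" "1 \<in> series.span (set Us \<union> series_ideal_of (germ f) (germ g))"
    and "\<And>u. u \<in> set Us \<Longrightarrow> y * u \<in> series.span (set Us \<union> series_ideal_of (germ f) (germ g))"
    and "\<And>u. u \<in> set Us \<Longrightarrow> z * u \<in> series.span (set Us \<union> series_ideal_of (germ f) (germ g))"
  shows "intersection_index f g \<le> enat (length Us)"
  using dim_le[OF assms(1) convergent_series_in_span[of "set Us"]] assms
  by (auto simp: intersection_index_eq)

text \<open>If the dimension is infinite the bound is trivial; otherwise \<open>le_dim\<close>
  applies, since the functionals kill all multiples of both generators.\<close>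

lemma le_intersection_index:
  fixes \<phi> :: "nat \<Rightarrow> complex fps fps \<Rightarrow> complex" and e :: "nat \<Rightarrow> complex fps fps"
  assumes "\<And>k F G. \<phi> k (F + G) = \<phi> k F + \<phi> k G" "\<And>k c F. \<phi> k (cst c * F) = c * \<phi> k F"
    and "\<And>k P. k < n \<Longrightarrow> \<phi> k (P * germ f) = 0" "\<And>k P. k < n \<Longrightarrow> \<phi> k (P * germ g) = 0"
    and "\<And>k. convergent_series (e k)"
    and "\<And>i k. k < n \<Longrightarrow> i < k \<Longrightarrow> \<phi> k (e i) = 0" "\<And>k. k < n \<Longrightarrow> \<phi> k (e k) \<noteq> 0"
  shows "enat n \<le> intersection_index f g"
proof (cases "Q.finite_dimension (h ` range cst) (carrier Q)")
  case True
  have "\<phi> k F = 0" if "k < n" "F \<in> series_ideal_of (germ f) (germ g)" for k F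
    using that assms(1,3,4) unfolding series_ideal_of_def by auto
  hence "n \<le> Q.dim (h ` range cst) (carrier Q)"
    using assms by (intro le_dim[OF True, of \<phi> n e]) auto
  thus ?thesis using True by (simp add: intersection_index_eq)
qed (simp add: intersection_index_eq)

text \<open>The vector \<open>(\<beta>, -\<alpha>)\<close> is annihilated by both linear parts. By
  the product rule, the derivative of \<open>P p\<close> along it at the origin is
  \<open>P(0)\<close> times that of \<open>p\<close>, as \<open>p\<close> vanishes there.\<close>

lemma two_le_intersection_index:
  assumes "\<alpha> \<noteq> 0 \<or> \<beta> \<noteq> 0"
    and "\<beta> * poly.coeff (poly.coeff f 1) 0 = \<alpha> * poly.coeff (poly.coeff f 0) 1"
    and "\<beta> * poly.coeff (poly.coeff g 1) 0 = \<alpha> * poly.coeff (poly.coeff g 0) 1"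
  shows "2 \<le> intersection_index f g"
proof -
  define \<phi> where "\<phi> k F = (if k = 0 then fps_nth (fps_nth F 0) 0
    else \<beta> * fps_nth (fps_nth F 1) 0 - \<alpha> * fps_nth (fps_nth F 0) 1)" for k :: nat and F :: "complex fps fps"
  \<comment> \<open>The derivative takes the value \<open>\<beta>\<close> on \<open>y\<close> and
    \<open>-\<alpha>\<close> on \<open>z\<close>; a coordinate with nonzero value is chosen.\<close>
  define e where "e k = (if k = 0 then 1 else if \<beta> \<noteq> 0 then y else z)" for k :: nat
  have vanish: "\<phi> k (P * germ p) = 0" if "poly.coeff (poly.coeff p 0) 0 = 0"
    "\<beta> * poly.coeff (poly.coeff p 1) 0 = \<alpha> * poly.coeff (poly.coeff p 0) 1" for k P p
  proof -
    have "\<phi> k (P * germ p) = (if k = 0 then 0 else fps_nth (fps_nth P 0) 0 *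
        (\<beta> * poly.coeff (poly.coeff p 1) 0 - \<alpha> * poly.coeff (poly.coeff p 0) 1))"
      using that(1) by (simp add: \<phi>_def germ_nth fps_mult_nth_1 algebra_simps)
    thus ?thesis using that by simp
  qed
  have "enat 2 \<le> intersection_index f g"
  proof (rule le_intersection_index[of \<phi> 2 e])
    show "\<phi> k (e k) \<noteq> 0" if "k < 2" for k
      using assms(1) by (auto simp: \<phi>_def e_def y_def z_def)
    show "\<phi> k (P * germ f) = 0" "\<phi> k (P * germ g) = 0" for k P
      using vanish origin assms by blast+
  qed (auto simp: \<phi>_def e_def cst_def algebra_simps)
  thus ?thesis by (simp add: numeral_eq_enat)
qed

end


section \<open>The three families\<close>

lemma germs_at_origin_families:
  "germs_at_origin (fam_f1 C) (fam_g1 C)" "germs_at_origin (fam_f2 C) (fam_g2 C)"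
  "germs_at_origin (fam_f3 C) (fam_g3 C)"
  by (auto simp: germs_at_origin_def fam_f1_def fam_g1_def fam_f2_def fam_g2_def fam_f3_def fam_g3_def
      Y_def Z_def K_def power2_eq_square power3_eq_cube)

lemma hom_component_1:
  "hom_component 1 p = K (poly.coeff (poly.coeff p 0) 1) * Z + K (poly.coeff (poly.coeff p 1) 0) * Y"
  by (simp add: hom_component_def)

lemma hom_component_1_eq_0_iff:
  "hom_component 1 p = 0 \<longleftrightarrow> poly.coeff (poly.coeff p 0) 1 = 0 \<and> poly.coeff (poly.coeff p 1) 0 = 0"
  unfolding hom_component_1 by (simp add: K_def Y_def Z_def)

text \<open>Without zero divisors, exactly one linear part vanishes; the coefficients of the other
  one serve as \<open>\<alpha>\<close> and \<open>\<beta>\<close>.\<close>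

lemma (in germs_at_origin) two_le_intersection_index_if_linear_part:
  assumes "hom_component 1 f * hom_component 1 g = 0" "(hom_component 1 f, hom_component 1 g) \<noteq> (0, 0)"
  shows "2 \<le> intersection_index f g"
proof -
  have "hom_component 1 f = 0 \<and> hom_component 1 g \<noteq> 0 \<or> hom_component 1 g = 0 \<and> hom_component 1 f \<noteq> 0"
    using assms by auto
  thus ?thesis
    unfolding hom_component_1_eq_0_iff
    using two_le_intersection_index[of "poly.coeff (poly.coeff g 1) 0" "poly.coeff (poly.coeff g 0) 1"]
      two_le_intersection_index[of "poly.coeff (poly.coeff f 1) 0" "poly.coeff (poly.coeff f 0) 1"]
    by auto
qed

lemma span_cancel_cst:
  assumes "c \<noteq> 0" "cst c * F \<in> series.span S"
  shows "F \<in> series.span S"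
  using series.span_scale[OF assms(2), of "inverse c"] assms(1) by (simp add: cst_simps)

section \<open>The upper bound seven by reduction to monomials\<close>

lemma intersection_index_le_7_family_1: "intersection_index (fam_f1 C) (fam_g1 C) \<le> 7"
proof -
  interpret germs_at_origin "fam_f1 C" "fam_g1 C" by (rule germs_at_origin_families)
  define I where "I = series_ideal_of (germ (fam_f1 C)) (germ (fam_g1 C))"
  \<comment> \<open>The monomials divisible by none of the leading monomials \<open>y^3\<close>,
    \<open>z^3\<close>, \<open>y z^2\<close>.\<close>
  define Us where "Us = [1, y, y^2, z, y * z, y^2 * z, z^2]"
  define V where "V = series.span (set Us \<union> I)"
  define F where "F = germ (fam_f1 C)"
  define G where "G = germ (fam_g1 C)"
  define a b e k h c d where coeffs: "a = cst (C 0 3 1 0)" "b = cst (C 0 3 0 1)" "e = cst (C 0 3 1 1)"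
    "k = cst (C 1 2 2 0)" "h = cst (C 1 2 1 1)" "c = cst (C 1 2 1 0)" "d = cst (C 1 2 0 1)"
  have F_eq: "F = - a * y - y^2 - b * z - e * y * z + h * z^2 - z^3"
    and G_eq: "G = - c * y - k * y^2 - d * z - h * y * z + y * z^2"
    by (simp_all add: F_def G_def fam_f1_def fam_g1_def germ_simps germ_power coeffs)
  have mem: "P * F + P' * G \<in> V" if "convergent_series P" "convergent_series P'" for P P'
    unfolding V_def I_def F_def G_def using that by (intro series.span_base UnI2 series_ideal_of_mem)
  \<comment> \<open>\<open>V\<close> is a complex span, so only constants may be pulled out; the
    finite list covers the coefficients that occur.\<close>
  have scale: "x \<in> V \<Longrightarrow> r * x \<in> V" if "r \<in> {a, b, e, k, h, c, d}" for r x
    using that series.span_scale unfolding V_def coeffs by auto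
  note closed = scale series.span_add[of _ "set Us \<union> I", folded V_def]
    series.span_diff[of _ "set Us \<union> I", folded V_def] series.span_neg[of _ "set Us \<union> I", folded V_def]
  have base: "1 \<in> V" "y \<in> V" "y^2 \<in> V" "z \<in> V" "y * z \<in> V" "y^2 * z \<in> V" "z^2 \<in> V"
    unfolding V_def Us_def by (auto intro: series.span_base)
  have z3: "z^3 \<in> V"
  proof -
    have "z^3 = - (a * y) - y^2 - b * z - e * (y * z) + h * z^2 - ((1 * F + 0 * G))"
      unfolding F_eq G_eq by (simp add: algebra_simps eval_nat_numeral)
    also have "\<dots> \<in> V" by (intro closed base mem) simp_all
    finally show ?thesis .
  qed
  have yz2: "y * z^2 \<in> V"
  proof -
    have "y * z^2 = c * y + k * y^2 + d * z + h * (y * z) + (0 * F + 1 * G)"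
      unfolding F_eq G_eq by (simp add: algebra_simps eval_nat_numeral)
    also have "\<dots> \<in> V" by (intro closed base mem) simp_all
    finally show ?thesis .
  qed
  have y3: "y^3 \<in> V"
  proof -
    \<comment> \<open>In \<open>y F + z G\<close> the terms \<open>y z^3\<close> cancel, as do the
      terms \<open>h y z^2\<close>, and \<open>- y^3\<close> is left.\<close>
    have "y^3 = - (a * y^2) - b * (y * z) - c * (y * z) - e * (y^2 * z) - k * (y^2 * z) - d * z^2 - (y * F + z * G)"
      unfolding F_eq G_eq by (simp add: algebra_simps eval_nat_numeral)
    also have "\<dots> \<in> V" by (intro closed base mem) simp_all
    finally show ?thesis .
  qed
  have y2z2: "y^2 * z^2 \<in> V"
  proof -
    have "y^2 * z^2 = c * y^2 + k * y^3 + d * (y * z) + h * (y^2 * z) + (0 * F + y * G)"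
      unfolding F_eq G_eq by (simp add: algebra_simps eval_nat_numeral)
    also have "\<dots> \<in> V" by (intro closed base mem y3) simp_all
    finally show ?thesis .
  qed
  have y3z: "y^3 * z \<in> V"
  proof -
    have "y^3 * z = - (a * (y^2 * z)) - b * (y * z^2) - c * (y * z^2) - e * (y^2 * z^2) - k * (y^2 * z^2) - d * z^3
        - ((y * z) * F + (z * z) * G)"
      unfolding F_eq G_eq by (simp add: algebra_simps eval_nat_numeral)
    also have "\<dots> \<in> V" by (intro closed base mem yz2 y2z2 z3) simp_all
    finally show ?thesis .
  qed
  have "intersection_index (fam_f1 C) (fam_g1 C) \<le> enat (length Us)"
  proof (rule intersection_index_le[of Us, folded I_def, folded V_def])
    show "set Us \<subseteq> carrier local_ring" by (simp add: Us_def local_ring_simps)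
    show "1 \<in> V" by (rule base)
    show "y * u \<in> V" if "u \<in> set Us" for u
      using that base yz2 y3 y3z by (auto simp: Us_def power2_eq_square power3_eq_cube mult_ac)
    show "z * u \<in> V" if "u \<in> set Us" for u
      using that base yz2 z3 y2z2 by (auto simp: Us_def power2_eq_square power3_eq_cube mult_ac)
  qed
  also have "enat (length Us) = 7"
    by (simp add: Us_def numeral_eq_enat)
  finally show ?thesis .
qed

text \<open>\<open>F\<close> and \<open>G\<close> reduce \<open>y z^2\<close> and
  \<open>y^2 z\<close> but no pure power. In \<open>y F + z G\<close> both \<open>y^3\<close> and
  \<open>m z^3\<close> occur, so \<open>y^3\<close> is kept as a basis element and
  \<open>z^3\<close> is reduced.\<close>

lemma intersection_index_le_7_family_2:
  assumes "C 2 1 0 2 \<noteq> 0"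
  shows "intersection_index (fam_f2 C) (fam_g2 C) \<le> 7"
proof -
  interpret germs_at_origin "fam_f2 C" "fam_g2 C" by (rule germs_at_origin_families)
  define I where "I = series_ideal_of (germ (fam_f2 C)) (germ (fam_g2 C))"
  define Us where "Us = [1, y, y^2, y^3, z, y * z, z^2]"
  define V where "V = series.span (set Us \<union> I)"
  define F where "F = germ (fam_f2 C)"
  define G where "G = germ (fam_g2 C)"
  define a b e h c d m where coeffs: "a = cst (C 1 2 1 0)" "b = cst (C 1 2 0 1)" "e = cst (C 2 1 2 0)"
    "h = cst (C 2 1 1 1)" "c = cst (C 2 1 1 0)" "d = cst (C 2 1 0 1)" "m = cst (C 2 1 0 2)"
  have F_eq: "F = - a * y - y^2 - b * z + e * y * z + h * z^2 - y * z^2"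
    and G_eq: "G = - c * y - e * y^2 - d * z - h * y * z + y^2 * z - m * z^2"
    by (simp_all add: F_def G_def fam_f2_def fam_g2_def germ_simps germ_power coeffs)
  have mem: "P * F + P' * G \<in> V" if "convergent_series P" "convergent_series P'" for P P'
    unfolding V_def I_def F_def G_def using that by (intro series.span_base UnI2 series_ideal_of_mem)
  have scale: "x \<in> V \<Longrightarrow> r * x \<in> V" if "r \<in> {a, b, e, h, c, d, m}" for r x
    using that series.span_scale unfolding V_def coeffs by auto
  note closed = scale series.span_add[of _ "set Us \<union> I", folded V_def]
    series.span_diff[of _ "set Us \<union> I", folded V_def] series.span_neg[of _ "set Us \<union> I", folded V_def]
  have base: "1 \<in> V" "y \<in> V" "y^2 \<in> V" "y^3 \<in> V" "z \<in> V" "y * z \<in> V" "z^2 \<in> V"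
    unfolding V_def Us_def by (auto intro: series.span_base)
  have yz2: "y * z^2 \<in> V"
  proof -
    have "y * z^2 = - (a * y) - y^2 - b * z + e * (y * z) + h * z^2 - (1 * F + 0 * G)"
      unfolding F_eq G_eq by (simp add: algebra_simps eval_nat_numeral)
    also have "\<dots> \<in> V" by (intro closed base mem) simp_all
    finally show ?thesis .
  qed
  have y2z: "y^2 * z \<in> V"
  proof -
    have "y^2 * z = c * y + e * y^2 + d * z + h * (y * z) + m * z^2 + (0 * F + 1 * G)"
      unfolding F_eq G_eq by (simp add: algebra_simps eval_nat_numeral)
    also have "\<dots> \<in> V" by (intro closed base mem) simp_all
    finally show ?thesis .
  qed
  have z3: "z^3 \<in> V"
  proof -
    have "m * z^3 = - (a * y^2) - b * (y * z) - c * (y * z) - d * z^2 - y^3 - (y * F + z * G)"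
      unfolding F_eq G_eq by (simp add: algebra_simps eval_nat_numeral)
    also have "\<dots> \<in> V" by (intro closed base mem) simp_all
    finally show ?thesis
      unfolding coeffs V_def by (rule span_cancel_cst[OF assms])
  qed
  have yz3: "y * z^3 \<in> V"
  proof -
    have "y * z^3 = - (a * (y * z)) - y^2 * z - b * z^2 + e * (y * z^2) + h * z^3 - (z * F + 0 * G)"
      unfolding F_eq G_eq by (simp add: algebra_simps eval_nat_numeral)
    also have "\<dots> \<in> V" by (intro closed base mem y2z yz2 z3) simp_all
    finally show ?thesis .
  qed
  have y4: "y^4 \<in> V"
  proof -
    \<comment> \<open>\<open>y\<close> times the relation for \<open>z^3\<close>; its term
      \<open>m y z^3\<close> is why \<open>yz3\<close> comes before.\<close>
    have "y^4 = - (a * y^3) - b * (y^2 * z) - c * (y^2 * z) - d * (y * z^2) - m * (y * z^3)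
        - ((y * y) * F + (y * z) * G)"
      unfolding F_eq G_eq by (simp add: algebra_simps eval_nat_numeral)
    also have "\<dots> \<in> V" by (intro closed base mem y2z yz2 yz3) simp_all
    finally show ?thesis .
  qed
  have y3z: "y^3 * z \<in> V"
  proof -
    have "y^3 * z = c * y^2 + e * y^3 + d * (y * z) + h * (y^2 * z) + m * (y * z^2) + (0 * F + y * G)"
      unfolding F_eq G_eq by (simp add: algebra_simps eval_nat_numeral)
    also have "\<dots> \<in> V" by (intro closed base mem y2z yz2) simp_all
    finally show ?thesis .
  qed
  have "intersection_index (fam_f2 C) (fam_g2 C) \<le> enat (length Us)"
  proof (rule intersection_index_le[of Us, folded I_def, folded V_def])
    show "set Us \<subseteq> carrier local_ring" by (simp add: Us_def local_ring_simps)
    show "1 \<in> V" by (rule base)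
    show "y * u \<in> V" if "u \<in> set Us" for u
      using that base yz2 y2z y4 by (auto simp: Us_def power2_eq_square power3_eq_cube power4_eq_xxxx mult_ac)
    show "z * u \<in> V" if "u \<in> set Us" for u
      using that base yz2 y2z y3z z3 by (auto simp: Us_def power2_eq_square power3_eq_cube mult_ac)
  qed
  also have "enat (length Us) = 7"
    by (simp add: Us_def numeral_eq_enat)
  finally show ?thesis .
qed

text \<open>Here \<open>F\<close> and \<open>G\<close> reduce \<open>y^2 z\<close> and
  \<open>y^3\<close>, while \<open>y F + z G\<close> links \<open>m z^3\<close> with
  \<open>y z^2\<close>; the latter is kept in the basis.\<close>

lemma intersection_index_le_7_family_3:
  assumes "C 3 0 0 2 \<noteq> 0"
  shows "intersection_index (fam_f3 C) (fam_g3 C) \<le> 7"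
proof -
  interpret germs_at_origin "fam_f3 C" "fam_g3 C" by (rule germs_at_origin_families)
  define I where "I = series_ideal_of (germ (fam_f3 C)) (germ (fam_g3 C))"
  define Us where "Us = [1, y, y^2, z, y * z, z^2, y * z^2]"
  define V where "V = series.span (set Us \<union> I)"
  define F where "F = germ (fam_f3 C)"
  define G where "G = germ (fam_g3 C)"
  define a b e h c d m where coeffs: "a = cst (C 2 1 1 0)" "b = cst (C 2 1 0 1)" "e = cst (C 3 0 2 0)"
    "h = cst (C 3 0 1 1)" "c = cst (C 3 0 1 0)" "d = cst (C 3 0 0 1)" "m = cst (C 3 0 0 2)"
  have F_eq: "F = - a * y - b * z + e * y * z - y^2 * z + (h - 1) * z^2"
    and G_eq: "G = - c * y - e * y^2 + y^3 - d * z - h * y * z - m * z^2"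
    by (simp_all add: F_def G_def fam_f3_def fam_g3_def germ_simps germ_power coeffs cst_simps)
  have mem: "P * F + P' * G \<in> V" if "convergent_series P" "convergent_series P'" for P P'
    unfolding V_def I_def F_def G_def using that by (intro series.span_base UnI2 series_ideal_of_mem)
  have scale: "x \<in> V \<Longrightarrow> r * x \<in> V" if "r \<in> {a, b, e, h, c, d, m}" for r x
    using that series.span_scale unfolding V_def coeffs by auto
  note closed = scale series.span_add[of _ "set Us \<union> I", folded V_def]
    series.span_diff[of _ "set Us \<union> I", folded V_def] series.span_neg[of _ "set Us \<union> I", folded V_def]
  have base: "1 \<in> V" "y \<in> V" "y^2 \<in> V" "z \<in> V" "y * z \<in> V" "z^2 \<in> V" "y * z^2 \<in> V"
    unfolding V_def Us_def by (auto intro: series.span_base)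
  have y2z: "y^2 * z \<in> V"
  proof -
    have "y^2 * z = - (a * y) - b * z + e * (y * z) + h * z^2 - z^2 - (1 * F + 0 * G)"
      unfolding F_eq G_eq by (simp add: algebra_simps eval_nat_numeral)
    also have "\<dots> \<in> V" by (intro closed base mem) simp_all
    finally show ?thesis .
  qed
  have y3: "y^3 \<in> V"
  proof -
    have "y^3 = c * y + e * y^2 + d * z + h * (y * z) + m * z^2 + (0 * F + 1 * G)"
      unfolding F_eq G_eq by (simp add: algebra_simps eval_nat_numeral)
    also have "\<dots> \<in> V" by (intro closed base mem) simp_all
    finally show ?thesis .
  qed
  have z3: "z^3 \<in> V"
  proof -
    have "m * z^3 = - (a * y^2) - b * (y * z) - c * (y * z) - d * z^2 - y * z^2 - (y * F + z * G)"
      unfolding F_eq G_eq by (simp add: algebra_simps eval_nat_numeral)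
    also have "\<dots> \<in> V" by (intro closed base mem) simp_all
    finally show ?thesis
      unfolding coeffs V_def by (rule span_cancel_cst[OF assms])
  qed
  have y2z2: "y^2 * z^2 \<in> V"
  proof -
    have "y^2 * z^2 = - (a * (y * z)) - b * z^2 + e * (y * z^2) + h * z^3 - z^3 - (z * F + 0 * G)"
      unfolding F_eq G_eq by (simp add: algebra_simps eval_nat_numeral)
    also have "\<dots> \<in> V" by (intro closed base mem z3) simp_all
    finally show ?thesis .
  qed
  have yz3: "y * z^3 \<in> V"
  proof -
    \<comment> \<open>\<open>y\<close> times the relation for \<open>z^3\<close>; the resulting
      \<open>y^2 z^2\<close> has just been reduced by means of \<open>z F\<close>.\<close>
    have "m * (y * z^3) = - (a * y^3) - b * (y^2 * z) - c * (y^2 * z) - d * (y * z^2) - y^2 * z^2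
        - ((y * y) * F + (y * z) * G)"
      unfolding F_eq G_eq by (simp add: algebra_simps eval_nat_numeral)
    also have "\<dots> \<in> V" by (intro closed base mem y3 y2z y2z2) simp_all
    finally show ?thesis
      unfolding coeffs V_def by (rule span_cancel_cst[OF assms])
  qed
  have "intersection_index (fam_f3 C) (fam_g3 C) \<le> enat (length Us)"
  proof (rule intersection_index_le[of Us, folded I_def, folded V_def])
    show "set Us \<subseteq> carrier local_ring" by (simp add: Us_def local_ring_simps)
    show "1 \<in> V" by (rule base)
    show "y * u \<in> V" if "u \<in> set Us" for u
      using that base y2z y3 y2z2 by (auto simp: Us_def power2_eq_square power3_eq_cube mult_ac)
    show "z * u \<in> V" if "u \<in> set Us" for u
      using that base y2z z3 yz3 by (auto simp: Us_def power2_eq_square power3_eq_cube mult_ac)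
  qed
  also have "enat (length Us) = 7"
    by (simp add: Us_def numeral_eq_enat)
  finally show ?thesis .
qed

text \<open>
  \<open>s\<close> is the branch \<open>y = s(z)\<close> of \<open>g = 0\<close>, correct modulo \<open>z\<^sup>7\<close>; the functionals below
  are the coefficients of \<open>F(s(z), z)\<close> up to \<open>z\<^sup>6\<close>, for which four terms suffice since
  \<open>s\<^sup>4\<close> is divisible by \<open>z\<^sup>8\<close>.
\<close>

lemma seven_le_intersection_index_family_2:
  assumes C: "C 1 2 1 0 = 0" "C 1 2 0 1 = 0" "C 2 1 0 1 = 0" "C 2 1 2 0 = 0" "C 2 1 1 1 = 0"
    "C 2 1 1 0 = C 2 1 0 2" "C 2 1 0 2 \<noteq> 0"
  shows "7 \<le> intersection_index (fam_f2 C) (fam_g2 C)"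
proof -
  interpret germs_at_origin "fam_f2 C" "fam_g2 C" by (rule germs_at_origin_families)
  define m where "m = C 2 1 0 2"
  define X :: "complex fps" where "X = fps_X"
  \<comment> \<open>On \<open>g = 0\<close> one has \<open>y = -z^2 + y^2 z/m\<close>. Inserting
    \<open>y = -z^2\<close> on the right gives this \<open>s\<close>; the next correction has order
    8.\<close>
  define s where "s = - (X^2) + fps_const (1 / m) * X^5"
  define sub :: "complex fps fps \<Rightarrow> complex fps" where
    "sub F = fps_nth F 0 + fps_nth F 1 * s + fps_nth F 2 * s^2 + fps_nth F 3 * s^3" for F
  define \<phi> where "\<phi> k F = fps_nth (sub F) k" for k F
  have m: "m \<noteq> 0" "fps_const m * fps_const (1 / m) = (1 :: complex fps)"
    using C by (simp_all add: m_def)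
  have f_eq: "germ (fam_f2 C) = - (y * y) - y * z^2"
    and g_eq: "germ (fam_g2 C) = - (cst m * y) + y * y * z - cst m * z^2"
    unfolding fam_f2_def fam_g2_def C(1-6)
    by (simp_all add: germ_simps germ_power cst_simps m_def power2_eq_square)
  have sub_add: "sub (F + G) = sub F + sub G" and sub_diff: "sub (F - G) = sub F - sub G"
    and sub_neg: "sub (- F) = - sub F" for F G
    by (simp_all add: sub_def algebra_simps)
  have sub_cst: "sub (cst c * F) = fps_const c * sub F" for c F
    by (simp add: sub_def cst_def algebra_simps)
  have sub_z: "sub (z * F) = X * sub F" for F
    by (simp add: sub_def z_def X_def algebra_simps)
  have sub_z2: "sub (z^2 * F) = X^2 * sub F" for F
    by (simp add: power2_eq_square mult.assoc sub_z)
  \<comment> \<open>Dropping the powers of \<open>y\<close> above the third makes \<open>sub\<close>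
    multiplicative only up to a multiple of \<open>s^4\<close>, which is harmless modulo
    \<open>X^7\<close>.\<close>
  have sub_y: "sub (y * F) = s * sub F - fps_nth F 3 * s^4" for F
    by (simp add: sub_def y_def eval_nat_numeral algebra_simps)
  have low: "fps_nth (X^7 * F) k = 0" if "k < 7" for F k
    using that by (simp add: X_def fps_X_power_mult_nth)
  define t where "t = - 1 + fps_const (1 / m) * X^3"
  have s_t: "s = X^2 * t"
    by (simp add: s_def t_def eval_nat_numeral algebra_simps)
  have s4: "s^4 = X^7 * (X * t^4)"
    unfolding s_t by (simp add: eval_nat_numeral mult_ac)
  have sub_f: "X^7 dvd sub (P * germ (fam_f2 C))" for P
  proof -
    have P_eq: "P * germ (fam_f2 C) = - (y * (y * P)) - z^2 * (y * P)"
      unfolding f_eq by (simp add: algebra_simps)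
    have "sub (P * germ (fam_f2 C)) = - (s * (s + X^2)) * sub P
        + s^4 * (fps_nth (y * P) 3 + (s + X^2) * fps_nth P 3)"
      unfolding P_eq sub_neg sub_diff sub_y sub_z2 by (simp add: algebra_simps)
    \<comment> \<open>The order seven itself: \<open>s\<close> contributes \<open>X^2 t\<close> and
      \<open>s + X^2\<close> contributes \<open>X^5/m\<close>.\<close>
    also have "- (s * (s + X^2)) = X^7 * (- t * fps_const (1 / m))"
      unfolding s_t by (simp add: t_def eval_nat_numeral algebra_simps)
    finally show ?thesis unfolding s4 by (simp add: mult.assoc)
  qed
  have sub_g: "X^7 dvd sub (P * germ (fam_g2 C))" for P
  proof -
    have P_eq: "P * germ (fam_g2 C) = - (cst m * (y * P)) + z * (y * (y * P)) - cst m * (z^2 * P)"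
      unfolding g_eq by (simp add: algebra_simps)
    have "sub (P * germ (fam_g2 C)) = (s * s * X - fps_const m * (s + X^2)) * sub P
        + s^4 * (fps_const m * fps_nth P 3 - X * fps_nth (y * P) 3 - X * s * fps_nth P 3)"
      unfolding P_eq sub_add sub_neg sub_diff sub_y sub_z sub_z2 sub_cst by (simp add: algebra_simps)
    also have "s + X^2 = fps_const (1 / m) * X^5"
      by (simp add: s_def)
    also have "fps_const m * (fps_const (1 / m) * X^5) = X^5"
      using m(2) by (metis mult.assoc mult_1)
    \<comment> \<open>The difference is \<open>X^5 (t^2 - 1)\<close>, and
      \<open>t + 1 = X^3/m\<close> gives three further orders.\<close>
    also have "s * s * X - X^5 = X^7 * (X * (fps_const (1 / m) * (t - 1)))"
      unfolding s_t by (simp add: t_def eval_nat_numeral algebra_simps)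
    finally show ?thesis unfolding s4 by (simp add: mult.assoc)
  qed
  have "enat 7 \<le> intersection_index (fam_f2 C) (fam_g2 C)"
  \<comment> \<open>Since \<open>z^k\<close> restricts to \<open>X^k\<close>, the matrix of the
    functionals on these powers is the identity.\<close>
  proof (rule le_intersection_index[of \<phi> 7 "\<lambda>k. z ^ k"])
    show "\<phi> k (P * germ (fam_f2 C)) = 0" "\<phi> k (P * germ (fam_g2 C)) = 0" if "k < 7" for k P
      using sub_f[of P] sub_g[of P] that by (auto simp: \<phi>_def low elim!: dvdE)
    have "sub (z ^ k) = X ^ k" for k
    proof (induction k)
      case 0
      show ?case by (simp add: sub_def)
    qed (simp add: sub_z)
    thus "\<phi> k (z ^ i) = 0" if "i < k" for i k
      using that by (simp add: \<phi>_def X_def)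
    show "\<phi> k (z ^ k) \<noteq> 0" for k
      using \<open>\<And>k. sub (z ^ k) = X ^ k\<close> by (simp add: \<phi>_def X_def)
  qed (simp_all add: \<phi>_def sub_add sub_cst)
  thus ?thesis by (simp add: numeral_eq_enat)
qed

theorem theorem5p6:
  shows "(\<forall>f g. (f, g) \<in> F1 \<union> F2 \<union> F3 \<and>
            hom_component 1 f * hom_component 1 g = 0 \<and>
            (hom_component 1 f, hom_component 1 g) \<noteq> (0, 0) \<longrightarrow>
            2 \<le> intersection_index f g \<and> intersection_index f g \<le> 7) \<and>
         (\<forall>C. C 1 2 1 0 = 0 \<and> C 1 2 0 1 = 0 \<and> C 2 1 0 1 = 0 \<and> C 2 1 2 0 = 0 \<and> C 2 1 1 1 = 0 \<and>
            C 2 1 1 0 = C 2 1 0 2 \<and> C 2 1 0 2 \<noteq> 0 \<longrightarrow>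
            intersection_index (fam_f2 C) (fam_g2 C) = 7)"
proof (intro conjI allI impI; elim conjE)
  fix f g assume *: "hom_component 1 f * hom_component 1 g = 0"
    "(hom_component 1 f, hom_component 1 g) \<noteq> (0, 0)" and "(f, g) \<in> F1 \<union> F2 \<union> F3"
  hence "germs_at_origin f g"
    using germs_at_origin_families by (auto simp: F1_def F2_def F3_def)
  thus "2 \<le> intersection_index f g"
    using * by (rule germs_at_origin.two_le_intersection_index_if_linear_part)
next
  fix f g assume "(f, g) \<in> F1 \<union> F2 \<union> F3"
  thus "intersection_index f g \<le> 7"
    using intersection_index_le_7_family_1 intersection_index_le_7_family_2 intersection_index_le_7_family_3
    by (auto simp: F1_def F2_def F3_def)
next
  fix C :: coefficients
  assume C: "C 1 2 1 0 = 0" "C 1 2 0 1 = 0" "C 2 1 0 1 = 0" "C 2 1 2 0 = 0" "C 2 1 1 1 = 0"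
    "C 2 1 1 0 = C 2 1 0 2" "C 2 1 0 2 \<noteq> 0"
  show "intersection_index (fam_f2 C) (fam_g2 C) = 7"
    using intersection_index_le_7_family_2[of C, OF C(7)] seven_le_intersection_index_family_2[of C, OF C]
    by (rule antisym)
qed

end
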